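(* Let $p, q \in \mathbb{R}[x,y]$ be the polynomials $$p=4x^6y^3+12x^5y^2+12x^4y+4x^3y^2+4x^3+5x^2y+x+y,$$ $$q=-\left(4x^4y^2+8x^3y+4x^2+2xy+1\right)\cdot\left(4x^6y^3+12x^5y^2+12x^4y+4x^3y^2+4x^3+7x^2y+3x+y\right).$$ Let $\psi:\mathbb{R}^2\to\mathbb{R}^2$ be defined by $$\psi(x,y)=\left((xy^2+x+y)(x-y),\ (xy+1)^2+x^2\right),$$ and let $\tilde{F}=(p+1,q):\mathbb{R}^2\to\mathbb{R}^2$. Then $\tilde{f}=\psi\circ\tilde{F}:\mathbb{R}^2\to\mathbb{R}^2$ is a non-injective polynomial map whose Jacobian determinant vanishes at no point of $\mathbb{R}^2$, and $\tilde{f}(\mathbb{R}^2)\subset\mathbb{R}\times\mathbb{R}^+$.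
   Context: $\mathbb{R}^+$ denotes the set of (strictly) positive real numbers. A polynomial map $\mathbb{R}^2\to\mathbb{R}^2$ is one whose two components are real polynomials in two variables; its Jacobian determinant is the determinant of its matrix of first-order partial derivatives. *)

theory Defs
  imports "HOL-Analysis.Analysis"
begin

definition p_poly :: "real \<Rightarrow> real \<Rightarrow> real" where
  "p_poly x y = 4*x^6*y^3 + 12*x^5*y^2 + 12*x^4*y + 4*x^3*y^2 + 4*x^3 + 5*x^2*y + x + y"

definition q_poly :: "real \<Rightarrow> real \<Rightarrow> real" where
  "q_poly x y =
     - ((4*x^4*y^2 + 8*x^3*y + 4*x^2 + 2*x*y + 1) *
        (4*x^6*y^3 + 12*x^5*y^2 + 12*x^4*y + 4*x^3*y^2 + 4*x^3 + 7*x^2*y + 3*x + y))"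

definition psi_map :: "real^2 \<Rightarrow> real^2" where
  "psi_map z = (let x = z $ 1; y = z $ 2 in
     vector [(x*y^2 + x + y) * (x - y), (x*y + 1)^2 + x^2])"

definition F_tilde :: "real^2 \<Rightarrow> real^2" where
  "F_tilde z = vector [p_poly (z $ 1) (z $ 2) + 1, q_poly (z $ 1) (z $ 2)]"

definition f_tilde :: "real^2 \<Rightarrow> real^2" where
  "f_tilde = psi_map \<circ> F_tilde"

end

theory Submission
  imports Defs
begin

text \<open>
  Both maps have Jacobian determinants that are sums of squares. For \<open>psi_map\<close> the sum of squares
  vanishes only at the origin (\<open>det_jacobian_psi_map\<close>), so by the chain rule it is enough that
  \<open>F_tilde\<close> has a nonvanishing Jacobian determinant and omits the origin. The second component of
  \<open>psi_map\<close> is positive because \<open>x y + 1\<close> and \<open>x\<close> have no common zero.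

  The structure of \<open>F_tilde\<close> becomes visible in the polynomials
  \<open>s = x (x y + 1)\<close>, \<open>r = 4 s\<^sup>2 + 2 x y + 1\<close> and \<open>m = p + 2 s\<close>. They satisfy
  \<open>q = - r m\<close> and \<open>r\<^sup>2 - m\<^sup>2 = 1 - p\<^sup>2\<close>, and the Jacobian determinant of \<open>(p, q)\<close> is
  \<open>2 (r\<^sup>2 + m\<^sup>2)\<close>. The rest follows from this:

  \<^item> \<open>r\<close> and \<open>m\<close> have no common zero (\<open>r_poly_or_m_poly_nonzero\<close>), so the determinant is positive.

  \<^item> If \<open>p = -1\<close> and \<open>q = 0\<close>, then \<open>r\<^sup>2 = m\<^sup>2\<close> and \<open>r m = 0\<close>, so \<open>r\<close> and \<open>m\<close> would both vanish.
    Hence \<open>F_tilde\<close> omits the origin (\<open>F_tilde_nonzero\<close>).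

  \<^item> The relations determine \<open>(r, m)\<close> from \<open>(p, q)\<close> only up to a common sign, and both signs occur
    over \<open>p = q = 1\<close>, so \<open>F_tilde\<close> takes one value twice (\<open>not_inj_F_tilde\<close>).
\<close>

section \<open>Differentiating plane maps\<close>

text \<open>The derivative is recorded by its two coefficients, so that the entries of a Jacobian matrix
  can be computed by the sum and product rules.\<close>

definition has_partials :: "(real^2 \<Rightarrow> real) \<Rightarrow> real \<Rightarrow> real \<Rightarrow> real^2 \<Rightarrow> bool" where
  "has_partials u a b z \<longleftrightarrow> (u has_derivative (\<lambda>h. a * h$1 + b * h$2)) (at z)"

lemma has_partials_fst: "has_partials (\<lambda>z. z$1) 1 0 z"
  and has_partials_snd: "has_partials (\<lambda>z. z$2) 0 1 z"
  by (simp_all add: has_partials_def bounded_linear_imp_has_derivative bounded_linear_vec_nth)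

lemma has_partials_const: "has_partials (\<lambda>z. c) 0 0 z"
  by (simp add: has_partials_def)

lemma has_partials_add:
  assumes "has_partials u a b z" "has_partials v c d z"
  shows "has_partials (\<lambda>z. u z + v z) (a + c) (b + d) z"
  using has_derivative_add[OF assms[unfolded has_partials_def]]
  by (simp add: has_partials_def algebra_simps)

lemma has_partials_diff:
  assumes "has_partials u a b z" "has_partials v c d z"
  shows "has_partials (\<lambda>z. u z - v z) (a - c) (b - d) z"
  using has_derivative_diff[OF assms[unfolded has_partials_def]]
  by (simp add: has_partials_def algebra_simps)

lemma has_partials_mult:
  assumes "has_partials u a b z" "has_partials v c d z"
  shows "has_partials (\<lambda>z. u z * v z) (a * v z + u z * c) (b * v z + u z * d) z"
  using has_derivative_mult[OF assms[unfolded has_partials_def]]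
  by (simp add: has_partials_def algebra_simps)

lemma has_partials_minus:
  assumes "has_partials u a b z"
  shows "has_partials (\<lambda>z. - u z) (- a) (- b) z"
  using has_derivative_minus[OF assms[unfolded has_partials_def]]
  by (simp add: has_partials_def algebra_simps)

lemma has_partials_power2:
  assumes "has_partials u a b z"
  shows "has_partials (\<lambda>z. (u z)\<^sup>2) (2 * u z * a) (2 * u z * b) z"
  using has_partials_mult[OF assms assms] by (simp add: power2_eq_square algebra_simps)

lemma has_partials_power3:
  assumes "has_partials u a b z"
  shows "has_partials (\<lambda>z. (u z)^3) (3 * (u z)\<^sup>2 * a) (3 * (u z)\<^sup>2 * b) z"
  using has_partials_mult[OF has_partials_power2[OF assms] assms]
  by (simp add: power2_eq_square power3_eq_cube algebra_simps)

lemma has_partials_eqI: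
  assumes "has_partials u a' b' z" "a' = a" "b' = b"
  shows "has_partials u a b z"
  using assms by simp

lemmas has_partials_intros =
  has_partials_fst has_partials_snd has_partials_const has_partials_add has_partials_diff
  has_partials_mult has_partials_minus has_partials_power2 has_partials_power3

lemma has_derivative_plane_map:
  assumes "has_partials u a b z" "has_partials v c d z"
  shows "((\<lambda>z. vector [u z, v z] :: real^2) has_derivative
           (\<lambda>h. vector [vector [a, b], vector [c, d]] *v h)) (at z)"
proof -
  have "((\<lambda>z. (vector [u z, v z] :: real^2) $ i) has_derivative
         (\<lambda>h. (vector [vector [a, b], vector [c, d]] *v h :: real^2) $ i)) (at z)" for i :: 2
    using assms exhaust_2[of i]
    by (auto simp: has_partials_def matrix_vector_mult_def sum_2)
  then show ?thesis
    by (subst has_derivative_componentwise_within)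
       (auto simp: Basis_vec_def inner_axis)
qed

lemma det_jacobian_plane_map:
  assumes "has_partials u a b z" "has_partials v c d z"
  shows "(\<lambda>z. vector [u z, v z] :: real^2) differentiable (at z)"
    and "det (jacobian (\<lambda>z. vector [u z, v z] :: real^2) (at z)) = a * d - b * c"
proof -
  note D = has_derivative_plane_map[OF assms]
  show "(\<lambda>z. vector [u z, v z] :: real^2) differentiable (at z)"
    using D by (auto simp: differentiable_def)
  show "det (jacobian (\<lambda>z. vector [u z, v z] :: real^2) (at z)) = a * d - b * c"
    unfolding jacobian_def frechet_derivative_at[OF D, symmetric]
    by (simp add: det_2)
qed

lemma jacobian_compose:
  fixes f :: "real^'n \<Rightarrow> real^'m" and g :: "real^'m \<Rightarrow> real^'k"
  assumes "f differentiable (at z)" "g differentiable (at (f z))"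
  shows "jacobian (g \<circ> f) (at z) = jacobian g (at (f z)) ** jacobian f (at z)"
proof -
  have "linear (frechet_derivative f (at z))" "linear (frechet_derivative g (at (f z)))"
    using assms by (simp_all add: linear_frechet_derivative)
  then show ?thesis
    by (simp add: jacobian_def frechet_derivative_compose[OF assms] matrix_compose)
qed

lemma polynomial_function_plane_map:
  assumes "real_polynomial_function u" "real_polynomial_function v"
  shows "polynomial_function (\<lambda>z. vector [u z, v z] :: real^2)"
  unfolding polynomial_function_iff_Basis_inner
  using assms by (auto simp: Basis_vec_def inner_axis forall_2)

lemma real_polynomial_function_vec_nth:
  "real_polynomial_function (\<lambda>z :: real^'n. z $ i)"
  by (intro real_polynomial_function.intros(1) bounded_linear_vec_nth)

lemmas real_polynomial_function_intros =
  real_polynomial_function_vec_nth real_polynomial_function.intros(2-)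
  real_polynomial_function_diff real_polynomial_function_minus real_polynomial_function_power

section \<open>The inner map\<close>

definition s_poly :: "real \<Rightarrow> real \<Rightarrow> real" where
  "s_poly x y = x * (x * y + 1)"

definition r_poly :: "real \<Rightarrow> real \<Rightarrow> real" where
  "r_poly x y = 4 * (s_poly x y)\<^sup>2 + 2 * (x * y) + 1"

definition m_poly :: "real \<Rightarrow> real \<Rightarrow> real" where
  "m_poly x y = p_poly x y + 2 * s_poly x y"

lemma p_poly_eq:
  "p_poly x y = 4 * (s_poly x y)^3 + 4 * (x * y) * s_poly x y + s_poly x y + y"
  unfolding p_poly_def s_poly_def by algebra

lemma q_poly_eq: "q_poly x y = - (r_poly x y * m_poly x y)"
  unfolding q_poly_def m_poly_def p_poly_def r_poly_def s_poly_def by algebra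

text \<open>Multiplying the formula for \<open>p\<close> by \<open>s\<close> and replacing \<open>y s\<close> by \<open>t (t + 1)\<close>, where
  \<open>t = x y\<close>, gives a quadratic equation for \<open>t\<close> over the polynomials in \<open>s\<close> and \<open>p\<close>; \<open>r\<^sup>2\<close> is its
  discriminant. Together with \<open>r m = - q\<close> this shows that \<open>(r, m)\<close> maps a fibre of \<open>(p, q)\<close>
  into the intersection of two (possibly degenerate) hyperbolas centred at the origin, hence into
  a set symmetric about the origin.\<close>

lemma r_poly_m_poly_hyperbola:
  "(r_poly x y)\<^sup>2 - (m_poly x y)\<^sup>2 = 1 - (p_poly x y)\<^sup>2"
  unfolding m_poly_def r_poly_def p_poly_def s_poly_def by algebra

text \<open>If both vanished, then \<open>p = - 2 s\<close> and the hyperbola relation would give \<open>4 s\<^sup>2 = 1\<close>, so that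
  \<open>r = 0\<close> forces \<open>x y = -1\<close>. But then \<open>s = x (x y + 1)\<close> is zero, a contradiction.\<close>

lemma r_poly_or_m_poly_nonzero: "r_poly x y \<noteq> 0 \<or> m_poly x y \<noteq> 0"
proof (rule ccontr)
  assume "\<not> ?thesis"
  then have r: "r_poly x y = 0" and m: "m_poly x y = 0"
    by simp_all
  have "p_poly x y = - 2 * s_poly x y"
    using m by (simp add: m_poly_def)
  then have s: "4 * (s_poly x y)\<^sup>2 = 1"
    using r_poly_m_poly_hyperbola[of x y] by (simp add: r m power_mult_distrib)
  then have "x * y + 1 = 0"
    using r by (simp add: r_poly_def)
  then have "s_poly x y = 0"
    by (simp add: s_poly_def)
  with s show False
    by simp
qed

text \<open>At a zero of \<open>F_tilde\<close>, \<open>p\<^sup>2 = 1\<close> and \<open>r m = 0\<close>, so the hyperbola relation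
  \<open>r\<^sup>2 = m\<^sup>2\<close> would make both \<open>r\<close> and \<open>m\<close> vanish.\<close>

lemma F_tilde_nonzero: "F_tilde z \<noteq> 0"
proof
  let ?x = "z$1" and ?y = "z$2"
  assume "F_tilde z = 0"
  then have p: "p_poly ?x ?y = -1" and q: "q_poly ?x ?y = 0"
    by (auto simp: F_tilde_def vec_eq_iff forall_2)
  have "r_poly ?x ?y = 0 \<or> m_poly ?x ?y = 0"
    using q by (simp add: q_poly_eq)
  moreover have "(r_poly ?x ?y)\<^sup>2 = (m_poly ?x ?y)\<^sup>2"
    using r_poly_m_poly_hyperbola[of ?x ?y] p by simp
  ultimately show False
    using r_poly_or_m_poly_nonzero[of ?x ?y] by auto
qed

text \<open>The calculation is done with Jacobian brackets \<open>{u, v} = u\<^sub>x v\<^sub>y - u\<^sub>y v\<^sub>x\<close>. Since \<open>q = - r m\<close>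
  and \<open>m = p + 2 s\<close>, the product rule gives \<open>{p, q} = - m {p, r} - 2 r {p, s}\<close>, and the two brackets
  on the right are \<open>- 2 m\<close> and \<open>- r\<close>.\<close>

lemma det_jacobian_F_tilde:
  fixes z :: "real^2"
  defines "x \<equiv> z$1" and "y \<equiv> z$2"
  shows "F_tilde differentiable (at z)"
    and "det (jacobian F_tilde (at z)) = 2 * (m_poly x y)\<^sup>2 + 2 * (r_poly x y)\<^sup>2"
proof -
  define s p r m where "s = s_poly x y" and "p = p_poly x y" and "r = r_poly x y"
    and "m = m_poly x y"
  define sx sy where "sx = 2 * x * y + 1" and "sy = x\<^sup>2"
  define rx ry where "rx = 8 * s * sx + 2 * y" and "ry = 8 * s * sy + 2 * x"
  define px py where "px = 12 * s\<^sup>2 * sx + 4 * y * s + 4 * (x * y) * sx + sx"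
    and "py = 12 * s\<^sup>2 * sy + 4 * x * s + 4 * (x * y) * sy + sy + 1"
  have ds: "has_partials (\<lambda>z. s_poly (z$1) (z$2)) sx sy z"
    unfolding s_poly_def
    by (rule has_partials_eqI, (rule has_partials_intros)+)
       (simp_all add: sx_def sy_def x_def y_def power2_eq_square algebra_simps)
  have dr: "has_partials (\<lambda>z. r_poly (z$1) (z$2)) rx ry z"
    unfolding r_poly_def
    by (rule has_partials_eqI, (rule has_partials_intros ds)+)
       (simp_all add: rx_def ry_def s_def x_def y_def algebra_simps)
  have dp: "has_partials (\<lambda>z. p_poly (z$1) (z$2)) px py z"
    unfolding p_poly_eq
    by (rule has_partials_eqI, (rule has_partials_intros ds)+)
       (simp_all add: px_def py_def s_def x_def y_def algebra_simps)
  have dm: "has_partials (\<lambda>z. m_poly (z$1) (z$2)) (px + 2 * sx) (py + 2 * sy) z"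
    unfolding m_poly_def
    by (rule has_partials_eqI, (rule has_partials_intros ds dp)+) simp_all
  have dq: "has_partials (\<lambda>z. q_poly (z$1) (z$2))
      (- (rx * m + r * (px + 2 * sx))) (- (ry * m + r * (py + 2 * sy))) z"
    unfolding q_poly_eq
    by (rule has_partials_eqI, (rule has_partials_intros dr dm)+)
       (simp_all add: r_def m_def x_def y_def algebra_simps)
  have dp1: "has_partials (\<lambda>z. p_poly (z$1) (z$2) + 1) px py z"
    by (rule has_partials_eqI, (rule has_partials_intros dp)+) simp_all
  have F: "F_tilde = (\<lambda>z. vector [p_poly (z$1) (z$2) + 1, q_poly (z$1) (z$2)])"
    by (simp add: fun_eq_iff F_tilde_def)
  show "F_tilde differentiable (at z)"
    unfolding F by (rule det_jacobian_plane_map[OF dp1 dq])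
  have s: "s = x * (x * y + 1)" and r: "r = 4 * s\<^sup>2 + 2 * (x * y) + 1"
    and m: "m = 4 * s^3 + 4 * (x * y) * s + 3 * s + y"
    by (simp_all add: s_def r_def m_def m_poly_def p_poly_eq r_poly_def s_poly_def)
  have ps: "px * sy - py * sx = - r"
    unfolding px_def py_def sx_def sy_def r using s by algebra
  have pr: "px * ry - py * rx = - 2 * m"
    unfolding px_def py_def rx_def ry_def sx_def sy_def m using s by algebra
  have "det (jacobian F_tilde (at z)) =
      px * (- (ry * m + r * (py + 2 * sy))) - py * (- (rx * m + r * (px + 2 * sx)))"
    unfolding F by (rule det_jacobian_plane_map[OF dp1 dq])
  also have "\<dots> = - m * (px * ry - py * rx) - 2 * r * (px * sy - py * sx)"
    by algebra
  also have "\<dots> = 2 * m\<^sup>2 + 2 * r\<^sup>2"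
    unfolding ps pr by algebra
  finally show "det (jacobian F_tilde (at z)) = 2 * (m_poly x y)\<^sup>2 + 2 * (r_poly x y)\<^sup>2"
    by (simp add: r_def m_def)
qed

lemma det_jacobian_F_tilde_pos: "det (jacobian F_tilde (at z)) > 0"
  using r_poly_or_m_poly_nonzero[of "z$1" "z$2"]
  by (auto simp: det_jacobian_F_tilde intro: add_pos_nonneg add_nonneg_pos)

text \<open>The two points lie over \<open>p = q = 1\<close>, where the hyperbolas \<open>r\<^sup>2 = m\<^sup>2\<close> and \<open>r m = -1\<close> meet in
  \<open>(r, m) = (-1, 1)\<close> and \<open>(1, -1)\<close>. The first has \<open>s = (m - p) / 2 = 0\<close>, hence \<open>x y = -1\<close>; the second
  has \<open>s = -1\<close>, hence \<open>x y = -2\<close>.\<close>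

lemma not_inj_F_tilde: "\<not> inj F_tilde"
proof
  assume "inj F_tilde"
  moreover have "F_tilde (vector [-1, 1]) = F_tilde (vector [1, -2])"
    by (simp add: F_tilde_def p_poly_def q_poly_def)
  ultimately have "(vector [-1, 1] :: real^2) = vector [1, -2]"
    by (rule injD)
  then show False
    by (auto simp: vec_eq_iff forall_2)
qed

lemma polynomial_function_F_tilde: "polynomial_function F_tilde"
  unfolding F_tilde_def p_poly_def q_poly_def
  by (intro polynomial_function_plane_map real_polynomial_function_intros)

section \<open>The outer map\<close>

text \<open>With \<open>b = x y + 1\<close> and \<open>a = x y\<^sup>2 + x + y = y b + x\<close>, \<open>psi_map\<close> has the components
  \<open>a (x - y)\<close> and \<open>b\<^sup>2 + x\<^sup>2\<close>; half the gradient of the second component is \<open>(a, x b)\<close>. In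
  the expansion of half the determinant by the product rule, the cofactor of \<open>x - y\<close> is then
  \<open>(y\<^sup>2 + 1) x b - (2 x y + 1) a = - y (b\<^sup>2 + x\<^sup>2)\<close> and that of \<open>a\<close> is \<open>a + x b\<close>. With
  \<open>b - x y = 1\<close> the cross terms combine into the stated sum of squares.\<close>

lemma det_jacobian_psi_map:
  fixes w :: "real^2"
  defines "x \<equiv> w$1" and "y \<equiv> w$2"
  shows "psi_map differentiable (at w)"
    and "det (jacobian psi_map (at w)) =
      2 * ((x * y\<^sup>2 + x + y)\<^sup>2 + (y * (x * y + 1))\<^sup>2 + (x * y)\<^sup>2 + x\<^sup>2)"
proof -
  define a b where "a = x * y\<^sup>2 + x + y" and "b = x * y + 1"
  have du: "has_partials (\<lambda>w. (w$1 * (w$2)\<^sup>2 + w$1 + w$2) * (w$1 - w$2))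
      ((y\<^sup>2 + 1) * (x - y) + a) ((2 * x * y + 1) * (x - y) - a) w"
    by (rule has_partials_eqI, (rule has_partials_intros)+)
       (simp_all add: a_def x_def y_def algebra_simps)
  have dv: "has_partials (\<lambda>w. (w$1 * w$2 + 1)\<^sup>2 + (w$1)\<^sup>2) (2 * b * y + 2 * x) (2 * b * x) w"
    by (rule has_partials_eqI, (rule has_partials_intros)+)
       (simp_all add: b_def x_def y_def algebra_simps)
  have psi: "psi_map = (\<lambda>w. vector [(w$1 * (w$2)\<^sup>2 + w$1 + w$2) * (w$1 - w$2),
      (w$1 * w$2 + 1)\<^sup>2 + (w$1)\<^sup>2])"
    by (simp add: fun_eq_iff psi_map_def Let_def)
  show "psi_map differentiable (at w)"
    unfolding psi by (rule det_jacobian_plane_map[OF du dv])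
  have "det (jacobian psi_map (at w)) =
      ((y\<^sup>2 + 1) * (x - y) + a) * (2 * b * x)
      - ((2 * x * y + 1) * (x - y) - a) * (2 * b * y + 2 * x)"
    unfolding psi by (rule det_jacobian_plane_map[OF du dv])
  also have "\<dots> = 2 * (a\<^sup>2 + (y * b)\<^sup>2 + (x * y)\<^sup>2 + x\<^sup>2)"
    unfolding a_def b_def by algebra
  finally show "det (jacobian psi_map (at w)) =
      2 * ((x * y\<^sup>2 + x + y)\<^sup>2 + (y * (x * y + 1))\<^sup>2 + (x * y)\<^sup>2 + x\<^sup>2)"
    by (simp add: a_def b_def)
qed

lemma det_jacobian_psi_map_pos:
  assumes "w \<noteq> 0"
  shows "det (jacobian psi_map (at w)) > 0"
proof (cases "w$1 = 0")
  case True
  with assms have "w$2 \<noteq> 0"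
    by (auto simp: vec_eq_iff forall_2)
  with True show ?thesis
    by (simp add: det_jacobian_psi_map)
next
  case False
  then have "(w$1)\<^sup>2 > 0"
    by simp
  then show ?thesis
    unfolding det_jacobian_psi_map(2) by (simp add: add_nonneg_pos)
qed

lemma psi_map_snd_pos: "psi_map w $ 2 > 0"
  by (cases "w$1 = 0") (simp_all add: psi_map_def Let_def add_nonneg_pos)

lemma polynomial_function_psi_map: "polynomial_function psi_map"
  unfolding psi_map_def Let_def
  by (intro polynomial_function_plane_map real_polynomial_function_intros)

section \<open>The composition\<close>

lemma det_jacobian_f_tilde_pos: "det (jacobian f_tilde (at z)) > 0"
  unfolding f_tilde_def
    jacobian_compose[OF det_jacobian_F_tilde(1) det_jacobian_psi_map(1)] det_mul
  by (intro mult_pos_pos det_jacobian_psi_map_pos F_tilde_nonzero det_jacobian_F_tilde_pos)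

theorem proposition2p3:
  shows "polynomial_function f_tilde \<and>
         \<not> inj f_tilde \<and>
         (\<forall>z. det (jacobian f_tilde (at z)) \<noteq> 0) \<and>
         range f_tilde \<subseteq> {w. w $ 2 > 0}"
proof (intro conjI allI)
  show "polynomial_function f_tilde"
    unfolding f_tilde_def
    by (intro polynomial_function_compose polynomial_function_F_tilde polynomial_function_psi_map)
  show "\<not> inj f_tilde"
    using not_inj_F_tilde unfolding f_tilde_def by (blast dest: inj_on_imageI2)
  show "det (jacobian f_tilde (at z)) \<noteq> 0" for z
    using det_jacobian_f_tilde_pos[of z] by simp
  show "range f_tilde \<subseteq> {w. w $ 2 > 0}"
    by (auto simp: f_tilde_def psi_map_snd_pos)
qed

end
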